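(* For each positive integer $m$, $d^*_{m+1}(2m)=D_{m-1}$ and $d_m(2m-1)=d^*_m(2m-1)=D_{m-1}$.
   Context: For a positive integer $n$, $S_n$ is the set of permutations of $\{1,\dots,n\}$, written in one-line notation $a_1a_2\cdots a_n$ with $a_i=w(i)$. A permutation is alternating if $a_1>a_2<a_3>a_4<\cdots$, and reverse alternating if $a_1<a_2>a_3<a_4>\cdots$. A fixed point of $w$ is an $i$ with $w(i)=i$. $d_k(n)$ (resp. $d^*_k(n)$) denotes the number of alternating (resp. reverse alternating) permutations in $S_n$ with exactly $k$ fixed points. $D_n$ denotes the number of derangements (permutations without fixed points) in $S_n$, with $D_0=1$. *)

theory Defs
  imports "HOL-Combinatorics.Permutations"
begin

text \<open>
  An element \<open>w\<close> of the symmetric group on \<open>{1..n}\<close> is a function with \<open>w permutes {1..n}\<close>.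
  Such a function is the identity outside \<open>{1..n}\<close>, so fixed points have to be
  counted inside \<open>{1..n}\<close> only.
\<close>

definition alternating :: "nat \<Rightarrow> (nat \<Rightarrow> nat) \<Rightarrow> bool" where
  "alternating n w \<longleftrightarrow>
     (\<forall>i. 1 \<le> i \<and> i < n \<longrightarrow> (if odd i then w i > w (i + 1) else w i < w (i + 1)))"

definition reverse_alternating :: "nat \<Rightarrow> (nat \<Rightarrow> nat) \<Rightarrow> bool" where
  "reverse_alternating n w \<longleftrightarrow>
     (\<forall>i. 1 \<le> i \<and> i < n \<longrightarrow> (if odd i then w i < w (i + 1) else w i > w (i + 1)))"

definition fixed_points :: "nat \<Rightarrow> (nat \<Rightarrow> nat) \<Rightarrow> nat set" where
  "fixed_points n w = {i \<in> {1..n}. w i = i}"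

definition d :: "nat \<Rightarrow> nat \<Rightarrow> nat" where
  "d k n = card {w. w permutes {1..n} \<and> alternating n w \<and> card (fixed_points n w) = k}"

definition d_star :: "nat \<Rightarrow> nat \<Rightarrow> nat" where
  "d_star k n =
     card {w. w permutes {1..n} \<and> reverse_alternating n w \<and> card (fixed_points n w) = k}"

text \<open>For \<open>n = 0\<close> the only permutation is the identity, which has no fixed points in
  \<open>{1..0}\<close>; this gives the convention that there is one derangement of the empty set.\<close>

definition derangements :: "nat \<Rightarrow> nat" where
  "derangements n = card {w. w permutes {1..n} \<and> fixed_points n w = {}}"

end

theory Submission
  imports Defs
begin

text \<open>
  In a reverse alternating permutation each descent \<open>w (2i) > w (2i+1)\<close> leaves room for at most
  one fixed point among \<open>2i\<close>, \<open>2i+1\<close>, so \<open>j \<mapsto> j div 2\<close> is injective on the fixed points and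
  there are at most \<open>n div 2 + 1\<close> of them. In the extremal case exactly one point of every pair
  is fixed, the other one being moved up if it is \<open>2i\<close> and down if it is \<open>2i+1\<close>. The moved
  points, one for each pair, carry a derangement; conversely a derangement \<open>\<sigma>\<close> determines from
  \<open>\<sigma> i > i\<close> or \<open>\<sigma> i < i\<close> which point of the \<open>i\<close>-th pair is moved, so nothing is lost.
  Conjugation by the reversal of \<open>{1..n}\<close> exchanges alternating and reverse alternating
  permutations for odd \<open>n\<close>.
\<close>

section \<open>Encoding by the pairs \<open>2 * i\<close>, \<open>2 * i + 1\<close>\<close>

text \<open>In the extremal case \<open>1\<close> is fixed, and so is \<open>2 * m\<close> when the
  length is \<open>2 * m\<close>. Restricting to \<open>{2..2 * m - 1}\<close> lets one set serve
  both lengths \<open>2 * m\<close> and \<open>2 * m - 1\<close>.\<close>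

definition extremal_perms :: "nat \<Rightarrow> (nat \<Rightarrow> nat) set" where
  "extremal_perms m = {w. w permutes {2..2 * m - 1} \<and>
     (\<forall>i\<in>{1..<m}. w (2 * i) = 2 * i \<and> w (2 * i + 1) < 2 * i + 1 \<or>
                  w (2 * i + 1) = 2 * i + 1 \<and> w (2 * i) > 2 * i)}"

definition derangement_perms :: "nat \<Rightarrow> (nat \<Rightarrow> nat) set" where
  "derangement_perms m = {s. s permutes {1..<m} \<and> (\<forall>i\<in>{1..<m}. s i \<noteq> i)}"

definition moved :: "(nat \<Rightarrow> nat) \<Rightarrow> nat \<Rightarrow> nat" where
  "moved w i = (if w (2 * i) = 2 * i then 2 * i + 1 else 2 * i)"

definition compress :: "(nat \<Rightarrow> nat) \<Rightarrow> nat \<Rightarrow> nat" where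
  "compress w i = w (moved w i) div 2"

text \<open>The counterpart of \<open>moved\<close>, read off from the direction in which
  \<open>s\<close> moves \<open>i\<close>. The defaults differ: for a pair with both points fixed
  \<open>moved\<close> gives \<open>2 * i + 1\<close>, while \<open>s i = i\<close> gives
  \<open>2 * i\<close> here.\<close>

definition place :: "(nat \<Rightarrow> nat) \<Rightarrow> nat \<Rightarrow> nat" where
  "place s i = (if s i < i then 2 * i + 1 else 2 * i)"

definition expand :: "(nat \<Rightarrow> nat) \<Rightarrow> nat \<Rightarrow> nat" where
  "expand s j = (if j = place s (j div 2) then place s (s (j div 2)) else j)"

lemma moved_div_2 [simp]: "moved w i div 2 = i"
  by (auto simp: moved_def)

lemma place_div_2 [simp]: "place s i div 2 = i"
  by (auto simp: place_def)

lemma expand_place [simp]: "expand s (place s i) = place s (s i)"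
  by (simp add: expand_def)

section \<open>From extremal permutations to derangements\<close>

lemma extremal_perms_outside:
  assumes "w \<in> extremal_perms m" "i \<notin> {1..<m}"
  shows "w (2 * i) = 2 * i" "w (2 * i + 1) = 2 * i + 1"
proof -
  have p: "w permutes {2..2 * m - 1}" using assms by (simp add: extremal_perms_def)
  have "2 * i \<notin> {2..2 * m - 1}" "2 * i + 1 \<notin> {2..2 * m - 1}"
    using assms(2) by auto
  then show "w (2 * i) = 2 * i" "w (2 * i + 1) = 2 * i + 1"
    using permutes_not_in[OF p] by blast+
qed

lemma extremal_perms_moved:
  assumes "w \<in> extremal_perms m" "j \<in> {2..2 * m - 1}"
  shows "w j \<noteq> j \<longleftrightarrow> j = moved w (j div 2)"
proof -
  have i: "j div 2 \<in> {1..<m}" using assms(2) by auto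
  have j: "j = 2 * (j div 2) \<or> j = 2 * (j div 2) + 1" by presburger
  define i where "i = j div 2"
  have "w (2 * i) = 2 * i \<and> w (2 * i + 1) < 2 * i + 1 \<or>
        w (2 * i + 1) = 2 * i + 1 \<and> w (2 * i) > 2 * i"
    using assms i unfolding i_def extremal_perms_def by blast
  then show ?thesis
    using j unfolding i_def[symmetric] moved_def by auto
qed

text \<open>By injectivity a non-fixed point has a non-fixed image, which must be the
  \<open>moved\<close> point of its own pair. So \<open>w\<close> acts on moved points as
  \<open>compress w\<close> acts on pair indices. Outside \<open>{1..<m}\<close> both sides are
  \<open>2 * i + 1\<close>.\<close>

lemma extremal_perms_moved_step:
  assumes w: "w \<in> extremal_perms m"
  shows "w (moved w i) = moved w (compress w i)"
proof (cases "i \<in> {1..<m}")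
  case True
  have p: "w permutes {2..2 * m - 1}" using w by (simp add: extremal_perms_def)
  have m: "moved w i \<in> {2..2 * m - 1}" using True by (auto simp: moved_def)
  have "w (moved w i) \<noteq> moved w i"
    using extremal_perms_moved[OF w m] by simp
  then have "w (w (moved w i)) \<noteq> w (moved w i)"
    using permutes_inj[OF p] by (simp add: inj_eq)
  then show ?thesis
    using extremal_perms_moved[OF w, of "w (moved w i)"] permutes_in_image[OF p] m
    by (simp add: compress_def)
next
  case False
  note o = extremal_perms_outside[OF w False]
  have m: "moved w i = 2 * i + 1" using o by (simp add: moved_def)
  have c: "compress w i = i" using o by (simp add: compress_def m)
  show ?thesis using o by (simp only: c m)
qed

lemma compress_outside:
  assumes "w \<in> extremal_perms m" "i \<notin> {1..<m}"
  shows "compress w i = i"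
  using extremal_perms_outside[OF assms] by (simp add: compress_def moved_def)

lemma compress_in_derangement_perms:
  assumes w: "w \<in> extremal_perms m"
  shows "compress w \<in> derangement_perms m"
proof -
  have p: "w permutes {2..2 * m - 1}" using w by (simp add: extremal_perms_def)
  have inj: "inj (compress w)"
  proof (rule injI)
    fix i k assume "compress w i = compress w k"
    then have "w (moved w i) = w (moved w k)"
      using extremal_perms_moved_step[OF w] by simp
    then have "moved w i = moved w k"
      using permutes_inj[OF p] by (simp add: inj_eq)
    then show "i = k" using moved_div_2 by metis
  qed
  \<comment> \<open>Outer indices are fixed by \<open>compress w\<close>, so by injectivity no inner
    index can land on one.\<close>
  have sub: "compress w i \<in> {1..<m}" if "i \<in> {1..<m}" for i
    using that compress_outside[OF w] inj by (metis inj_eq)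
  have "bij_betw (compress w) {1..<m} {1..<m}"
    unfolding bij_betw_def
    using endo_inj_surj[of "{1..<m}" "compress w"] sub inj
    by (meson finite_atLeastLessThan image_subsetI inj_on_subset subset_UNIV)
  then have "compress w permutes {1..<m}"
    using compress_outside[OF w] by (intro bij_imp_permutes)
  moreover have "compress w i \<noteq> i" if i: "i \<in> {1..<m}" for i
  proof
    assume "compress w i = i"
    then have "w (moved w i) = moved w i" using extremal_perms_moved_step[OF w, of i] by simp
    moreover have "moved w i \<in> {2..2 * m - 1}" using i by (auto simp: moved_def)
    ultimately show False using extremal_perms_moved[OF w, of "moved w i"] by simp
  qed
  ultimately show ?thesis by (simp add: derangement_perms_def)
qed

section \<open>From derangements back to extremal permutations\<close>

lemma expand_in_extremal_perms:
  assumes s: "s \<in> derangement_perms m"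
  shows "expand s \<in> extremal_perms m"
proof -
  have p: "s permutes {1..<m}" and ne: "\<And>i. i \<in> {1..<m} \<Longrightarrow> s i \<noteq> i"
    using s by (auto simp: derangement_perms_def)
  have inj: "inj (expand s)"
  proof (rule injI)
    fix a b assume ab: "expand s a = expand s b"
    have eq: "place s i = place s k \<Longrightarrow> i = k" for i k using place_div_2 by metis
    \<comment> \<open>If \<open>a\<close> is a placed point and \<open>b\<close> is not, then
      \<open>b = place s (s (a div 2))\<close>, which makes \<open>b\<close> the placed point of its
      own pair, a contradiction.\<close>
    show "a = b"
      using ab eq[of "s (a div 2)" "s (b div 2)"] permutes_inj[OF p]
      unfolding expand_def by (auto split: if_splits simp: inj_eq)
  qed
  \<comment> \<open>Since \<open>s\<close> fixes \<open>j div 2\<close> here, both branches of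
    \<open>expand\<close> return \<open>j\<close>.\<close>
  have out: "expand s j = j" if "j \<notin> {2..2 * m - 1}" for j
  proof -
    have "j div 2 \<notin> {1..<m}" using that by auto
    then have "s (j div 2) = j div 2" using permutes_not_in[OF p] by blast
    then show ?thesis by (simp add: expand_def)
  qed
  have sub: "expand s j \<in> {2..2 * m - 1}" if "j \<in> {2..2 * m - 1}" for j
    using that out inj by (metis inj_eq)
  have "bij_betw (expand s) {2..2 * m - 1} {2..2 * m - 1}"
    unfolding bij_betw_def
    using endo_inj_surj[of "{2..2 * m - 1}" "expand s"] sub inj
    by (meson finite_atLeastAtMost image_subsetI inj_on_subset subset_UNIV)
  then have "expand s permutes {2..2 * m - 1}"
    using out by (intro bij_imp_permutes)
  moreover have "expand s (2 * i) = 2 * i \<and> expand s (2 * i + 1) < 2 * i + 1 \<or>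
      expand s (2 * i + 1) = 2 * i + 1 \<and> expand s (2 * i) > 2 * i" if "i \<in> {1..<m}" for i
  proof (cases "s i < i")
    case True
    then have i: "place s i = 2 * i + 1" by (simp add: place_def)
    then have "expand s (2 * i + 1) = place s (s i)" by (metis expand_place)
    moreover have "place s (s i) < 2 * i + 1" using True by (auto simp: place_def)
    moreover have "expand s (2 * i) = 2 * i" using i by (simp add: expand_def)
    ultimately show ?thesis by simp
  next
    case False
    then have "s i > i" using ne[OF that] by simp
    then have i: "place s i = 2 * i" by (simp add: place_def)
    then have "expand s (2 * i) = place s (s i)" by (metis expand_place)
    moreover have "place s (s i) > 2 * i" using \<open>s i > i\<close> by (auto simp: place_def)
    moreover have "expand s (2 * i + 1) = 2 * i + 1" using i by (simp add: expand_def)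
    ultimately show ?thesis by simp
  qed
  ultimately show ?thesis by (simp add: extremal_perms_def)
qed

lemma compress_expand:
  assumes s: "s \<in> derangement_perms m"
  shows "compress (expand s) = s"
proof
  fix i
  show "compress (expand s) i = s i"
  proof (cases "i \<in> {1..<m}")
    case True
    then have "s i \<noteq> i" using s by (simp add: derangement_perms_def)
    \<comment> \<open>As \<open>s i \<noteq> i\<close>, the placed point is sent into another pair
      and hence really moves.\<close>
    then have "moved (expand s) i = place s i"
      by (auto simp: moved_def expand_def place_def)
    then show ?thesis by (simp add: compress_def)
  next
    case False
    then show ?thesis
      using compress_outside[OF expand_in_extremal_perms[OF s]] s
      by (auto simp: derangement_perms_def permutes_def)
  qed
qed

lemma expand_compress:
  assumes w: "w \<in> extremal_perms m"
  shows "expand (compress w) = w"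
proof -
  have p: "w permutes {2..2 * m - 1}" using w by (simp add: extremal_perms_def)
  have c: "compress w \<in> derangement_perms m" by (rule compress_in_derangement_perms[OF w])
  \<comment> \<open>The moved point leaves its pair because \<open>compress w i \<noteq> i\<close>:
    downwards if it is \<open>2 * i + 1\<close>, upwards if it is \<open>2 * i\<close>. This is the
    test made by \<open>place\<close>.\<close>
  have pl: "place (compress w) i = moved w i" if i: "i \<in> {1..<m}" for i
  proof -
    have G: "w (2 * i) = 2 * i \<and> w (2 * i + 1) < 2 * i + 1 \<or>
        w (2 * i + 1) = 2 * i + 1 \<and> w (2 * i) > 2 * i"
      using w i unfolding extremal_perms_def by blast
    have "compress w i \<noteq> i" using c i by (simp add: derangement_perms_def)
    then show ?thesis
      using G by (auto simp: place_def moved_def compress_def)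
  qed
  show ?thesis
  proof
    fix j
    show "expand (compress w) j = w j"
    proof (cases "j \<in> {2..2 * m - 1}")
      case True
      then have i: "j div 2 \<in> {1..<m}" by auto
      \<comment> \<open>The image index must be inner as well, since \<open>place\<close> and
        \<open>moved\<close> disagree on outer indices.\<close>
      have ci: "compress w (j div 2) \<in> {1..<m}"
        using c i permutes_in_image by (fastforce simp: derangement_perms_def)
      show ?thesis
        using extremal_perms_moved[OF w True] extremal_perms_moved_step[OF w, of "j div 2"]
        by (auto simp: expand_def pl[OF i] pl[OF ci])
    next
      case False
      then show ?thesis
        using permutes_not_in[OF p] expand_in_extremal_perms[OF c]
        by (simp add: extremal_perms_def permutes_def)
    qed
  qed
qed

lemma card_extremal_perms: "card (extremal_perms m) = derangements (m - 1)"
proof -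
  have "bij_betw compress (extremal_perms m) (derangement_perms m)"
    by (rule bij_betw_byWitness[where f' = expand])
       (auto simp: compress_expand expand_compress compress_in_derangement_perms
         expand_in_extremal_perms)
  moreover have "{1..<m} = {1..m - 1}" by auto
  then have "derangement_perms m = {s. s permutes {1..m - 1} \<and> fixed_points (m - 1) s = {}}"
    by (auto simp: derangement_perms_def fixed_points_def)
  ultimately show ?thesis
    by (simp add: derangements_def bij_betw_same_card)
qed

section \<open>The maximal number of fixed points and the extremal case\<close>

text \<open>Two fixed points in one pair would form an ascent from \<open>2 * i\<close> to
  \<open>2 * i + 1\<close>. The pair with \<open>i = 0\<close> is harmless because \<open>0\<close>
  is outside \<open>{1..n}\<close>.\<close>

lemma inj_on_div_2_fixed_points:
  assumes "\<And>i. 1 \<le> i \<Longrightarrow> 2 * i < n \<Longrightarrow> w (2 * i) > w (2 * i + 1)"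
  shows "inj_on (\<lambda>j. j div 2) (fixed_points n w)"
proof (rule linorder_inj_onI')
  fix a b assume ab: "a \<in> fixed_points n w" "b \<in> fixed_points n w" "a < b"
  show "a div 2 \<noteq> b div 2"
  proof
    assume "a div 2 = b div 2"
    then have "a = 2 * (a div 2)" "b = 2 * (a div 2) + 1" using \<open>a < b\<close> by presburger+
    moreover define i where "i = a div 2"
    ultimately have "a = 2 * i" "b = 2 * i + 1" by auto
    with ab assms[of i] show False by (auto simp: fixed_points_def)
  qed
qed

lemma reverse_alternating_extremal:
  assumes w: "w permutes {1..n}" "reverse_alternating n w"
    and card: "card (fixed_points n w) = n div 2 + 1"
    and m: "m \<ge> 1" "n = 2 * m \<or> n = 2 * m - 1"
  shows "w \<in> extremal_perms m"
proof -
  have alt: "w (2 * i) > w (2 * i + 1)" if "1 \<le> i" "2 * i < n" for i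
    using w(2) that unfolding reverse_alternating_def by (auto dest: spec[of _ "2 * i"])
  note inj = inj_on_div_2_fixed_points[OF alt]
  \<comment> \<open>The image has \<open>n div 2 + 1\<close> elements by injectivity, as many as the
    target. Hence every pair, including the incomplete ones at the ends, contains a fixed
    point.\<close>
  have "(\<lambda>j. j div 2) ` fixed_points n w = {0..n div 2}"
  proof (rule card_subset_eq)
    show "(\<lambda>j. j div 2) ` fixed_points n w \<subseteq> {0..n div 2}"
      by (auto simp: fixed_points_def div_le_mono)
  qed (simp_all add: card_image[OF inj] card)
  then have fix1: "\<exists>j. j div 2 = i \<and> 1 \<le> j \<and> j \<le> n \<and> w j = j" if "i \<le> n div 2" for i
  proof -
    have "i \<in> {0..n div 2}" using that by simp
    then have "i \<in> (\<lambda>j. j div 2) ` fixed_points n w"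
      using \<open>(\<lambda>j. j div 2) ` fixed_points n w = {0..n div 2}\<close> by blast
    then show ?thesis by (auto simp: fixed_points_def)
  qed
  have fixed_pair: "w (2 * i) = 2 * i \<or> w (2 * i + 1) = 2 * i + 1" if i: "i \<le> n div 2" for i
  proof -
    obtain j where j: "j div 2 = i" "w j = j" using fix1[OF i] by blast
    have "j = 2 * i \<or> j = 2 * i + 1" using j(1) by presburger
    then show ?thesis using j(2) by auto
  qed
  have w1: "w 1 = 1"
  proof -
    obtain j where "j div 2 = 0" "1 \<le> j" "w j = j" using fix1[of 0] by auto
    moreover from this have "j = 1" by presburger
    ultimately show ?thesis by simp
  qed
  \<comment> \<open>For \<open>n = 2 * m\<close> the last pair meets \<open>{1..n}\<close> only in
    \<open>2 * m\<close>; for \<open>n = 2 * m - 1\<close> the point \<open>2 * m\<close> lies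
    outside the support.\<close>
  have wm: "w (2 * m) = 2 * m"
  proof (cases "n = 2 * m")
    case True
    obtain j where "j div 2 = m" "j \<le> n" "w j = j" using fix1[of m] True by auto
    moreover from this have "j = 2 * m" using True by presburger
    ultimately show ?thesis by simp
  next
    case False
    then show ?thesis using m permutes_not_in[OF w(1), of "2 * m"] by auto
  qed
  have "w permutes {2..2 * m - 1}"
  proof (rule permutes_superset[OF w(1)])
    fix x assume "x \<in> {1..n} - {2..2 * m - 1}"
    then have "x = 1 \<or> x = 2 * m" using m by auto
    then show "w x = x" using w1 wm by auto
  qed
  moreover have "w (2 * i) = 2 * i \<and> w (2 * i + 1) < 2 * i + 1 \<or>
      w (2 * i + 1) = 2 * i + 1 \<and> w (2 * i) > 2 * i" if "i \<in> {1..<m}" for i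
  proof -
    have "1 \<le> i" "2 * i < n" "i \<le> n div 2" using that m by auto
    then show ?thesis using alt[of i] fixed_pair[of i] by linarith
  qed
  ultimately show ?thesis by (simp add: extremal_perms_def)
qed

lemma extremal_reverse_alternating:
  assumes w: "w \<in> extremal_perms m"
    and m: "m \<ge> 1" "n = 2 * m \<or> n = 2 * m - 1"
  shows "w permutes {1..n}" "reverse_alternating n w"
    "card (fixed_points n w) = n div 2 + 1"
proof -
  have p: "w permutes {2..2 * m - 1}" using w by (simp add: extremal_perms_def)
  show "w permutes {1..n}" using m by (intro permutes_subset[OF p]) auto
  \<comment> \<open>Injectivity sharpens the defining inequalities: the moved point cannot land on
    its fixed partner. Each alternative now yields a descent.\<close>
  have pair: "w (2 * i) = 2 * i \<and> w (2 * i + 1) < 2 * i \<or>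
        w (2 * i + 1) = 2 * i + 1 \<and> w (2 * i) > 2 * i + 1" if "i \<in> {1..<m}" for i
  proof -
    have "w (2 * i) = 2 * i \<and> w (2 * i + 1) < 2 * i + 1 \<or>
        w (2 * i + 1) = 2 * i + 1 \<and> w (2 * i) > 2 * i"
      using w that unfolding extremal_perms_def by blast
    moreover have "w (2 * i) \<noteq> w (2 * i + 1)"
      using permutes_inj[OF p] by (simp add: inj_eq)
    ultimately show ?thesis by linarith
  qed
  \<comment> \<open>These bounds give the ascents between consecutive pairs: \<open>w (2 * k + 1)
    \<le> 2 * k + 1 < 2 * k + 2 \<le> w (2 * k + 2)\<close>.\<close>
  have le: "w (2 * i) \<ge> 2 * i" "w (2 * i + 1) \<le> 2 * i + 1" for i
    using pair[of i] extremal_perms_outside[OF w, of i] by (cases "i \<in> {1..<m}"; force)+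
  show "reverse_alternating n w"
    unfolding reverse_alternating_def
  proof (intro allI impI)
    fix i assume i: "1 \<le> i \<and> i < n"
    show "if odd i then w i < w (i + 1) else w (i + 1) < w i"
    proof (cases "odd i")
      case True
      then obtain k where k: "i = 2 * k + 1" by (auto elim: oddE)
      then show ?thesis using le(2)[of k] le(1)[of "k + 1"] by simp
    next
      case False
      then obtain k where k: "i = 2 * k" by auto
      then have "k \<in> {1..<m}" using i m by auto
      then show ?thesis using pair[of k] k by auto
    qed
  qed
  have "bij_betw (\<lambda>j. j div 2) (fixed_points n w) {0..n div 2}"
    unfolding bij_betw_def
  proof
    show "inj_on (\<lambda>j. j div 2) (fixed_points n w)"
    proof (rule inj_on_div_2_fixed_points)
      fix i assume "1 \<le> i" "2 * i < n"
      then have "i \<in> {1..<m}" using m by auto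
      then show "w (2 * i) > w (2 * i + 1)" using pair[of i] by linarith
    qed
    show "(\<lambda>j. j div 2) ` fixed_points n w = {0..n div 2}"
    proof (intro equalityI subsetI)
      fix i assume "i \<in> {0..n div 2}"
      \<comment> \<open>The end pairs supply the fixed points \<open>1\<close> and, for even
        \<open>n\<close>, \<open>2 * m\<close>; each inner pair supplies one.\<close>
      then have "i = 0 \<or> i \<in> {1..<m} \<or> i = m \<and> n = 2 * m" using m by auto
      then consider "i = 0" | "i \<in> {1..<m}" | "i = m" "n = 2 * m" by blast
      then show "i \<in> (\<lambda>j. j div 2) ` fixed_points n w"
      proof cases
        case 1
        have "1 \<in> fixed_points n w"
          using m extremal_perms_outside(2)[OF w, of 0] by (auto simp: fixed_points_def)
        then show ?thesis using 1 by (intro image_eqI[of _ _ 1]) auto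
      next
        case 2
        then have "2 * i \<in> fixed_points n w \<or> 2 * i + 1 \<in> fixed_points n w"
          using pair[OF 2] m by (auto simp: fixed_points_def)
        then show ?thesis
        proof
          assume "2 * i \<in> fixed_points n w"
          then show ?thesis by (intro image_eqI[of _ _ "2 * i"]) auto
        next
          assume "2 * i + 1 \<in> fixed_points n w"
          then show ?thesis by (intro image_eqI[of _ _ "2 * i + 1"]) auto
        qed
      next
        case 3
        then have "2 * m \<in> fixed_points n w"
          using m extremal_perms_outside(1)[OF w, of m] by (auto simp: fixed_points_def)
        then show ?thesis using 3 by (intro image_eqI[of _ _ "2 * m"]) auto
      qed
    qed (auto simp: fixed_points_def div_le_mono)
  qed
  then show "card (fixed_points n w) = n div 2 + 1"
    using bij_betw_same_card by fastforce
qed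

lemma d_star_extremal:
  assumes "m \<ge> 1" "n = 2 * m \<or> n = 2 * m - 1"
  shows "d_star (n div 2 + 1) n = derangements (m - 1)"
proof -
  have "{w. w permutes {1..n} \<and> reverse_alternating n w \<and> card (fixed_points n w) = n div 2 + 1}
      = extremal_perms m"
    using reverse_alternating_extremal[OF _ _ _ assms] extremal_reverse_alternating[OF _ assms]
    by (intro set_eqI iffI CollectI conjI) simp_all
  then show ?thesis by (simp add: d_star_def card_extremal_perms)
qed

section \<open>Reversal symmetry for odd length\<close>

definition flip :: "nat \<Rightarrow> nat \<Rightarrow> nat" where
  "flip n i = (if i \<in> {1..n} then n + 1 - i else i)"

lemma flip_flip [simp]: "flip n (flip n i) = i"
  by (auto simp: flip_def)

lemma flip_permutes: "flip n permutes {1..n}"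
  unfolding permutes_def
proof (intro conjI allI impI)
  show "\<exists>!x. flip n x = y" for y by (metis flip_flip)
qed (auto simp: flip_def)

lemma flip_conj_permutes:
  assumes "w permutes {1..n}"
  shows "flip n \<circ> w \<circ> flip n permutes {1..n}"
  using assms flip_permutes by (intro permutes_compose)

lemma card_fixed_points_flip_conj:
  "card (fixed_points n (flip n \<circ> w \<circ> flip n)) = card (fixed_points n w)"
proof -
  have in_range: "flip n i \<in> {1..n} \<longleftrightarrow> i \<in> {1..n}" for i
    using permutes_in_image[OF flip_permutes] .
  have "flip n (w (flip n i)) = i \<longleftrightarrow> w (flip n i) = flip n i" for i
    by (metis flip_flip)
  then have "bij_betw (flip n) (fixed_points n (flip n \<circ> w \<circ> flip n)) (fixed_points n w)"
    using in_range
    by (intro bij_betw_byWitness[where f' = "flip n"])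
       (auto simp: fixed_points_def simp del: atLeastAtMost_iff)
  then show ?thesis by (rule bij_betw_same_card)
qed

text \<open>Conjugation reverses both positions and values, and the two reversals cancel: ascents
  stay ascents but move from \<open>i\<close> to \<open>n - i\<close>.\<close>

lemma flip_conj_less:
  assumes w: "w permutes {1..n}" and i: "1 \<le> i" "i < n"
  shows "(flip n \<circ> w \<circ> flip n) i < (flip n \<circ> w \<circ> flip n) (i + 1) \<longleftrightarrow> w (n - i) < w (n - i + 1)"
    "(flip n \<circ> w \<circ> flip n) i > (flip n \<circ> w \<circ> flip n) (i + 1) \<longleftrightarrow> w (n - i) > w (n - i + 1)"
proof -
  have "flip n i = n - i + 1" "flip n (i + 1) = n - i" using i by (auto simp: flip_def)
  moreover have "flip n a < flip n b \<longleftrightarrow> b < a" if "a \<in> {1..n}" "b \<in> {1..n}" for a b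
    using that by (auto simp: flip_def)
  moreover have "w (n - i) \<in> {1..n}" "w (n - i + 1) \<in> {1..n}"
    unfolding permutes_in_image[OF w] using i by auto
  ultimately show "(flip n \<circ> w \<circ> flip n) i < (flip n \<circ> w \<circ> flip n) (i + 1) \<longleftrightarrow> w (n - i) < w (n - i + 1)"
    "(flip n \<circ> w \<circ> flip n) i > (flip n \<circ> w \<circ> flip n) (i + 1) \<longleftrightarrow> w (n - i) > w (n - i + 1)"
    by simp_all
qed

text \<open>For odd \<open>n\<close> the positions \<open>i\<close> and \<open>n - i\<close> have
  opposite parity, so ascents and descents trade places.\<close>

lemma flip_conj_reverse_alternating:
  assumes "w permutes {1..n}" "odd n" "alternating n w"
  shows "reverse_alternating n (flip n \<circ> w \<circ> flip n)"
  unfolding reverse_alternating_def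
proof (intro allI impI)
  fix i assume i: "1 \<le> i \<and> i < n"
  then have "1 \<le> n - i \<and> n - i < n" "odd (n - i) \<longleftrightarrow> even i" using \<open>odd n\<close> by auto
  then show "if odd i then (flip n \<circ> w \<circ> flip n) i < (flip n \<circ> w \<circ> flip n) (i + 1)
      else (flip n \<circ> w \<circ> flip n) (i + 1) < (flip n \<circ> w \<circ> flip n) i"
    using flip_conj_less[OF assms(1)] i assms(3) unfolding alternating_def by metis
qed

lemma flip_conj_alternating:
  assumes "w permutes {1..n}" "odd n" "reverse_alternating n w"
  shows "alternating n (flip n \<circ> w \<circ> flip n)"
  unfolding alternating_def
proof (intro allI impI)
  fix i assume i: "1 \<le> i \<and> i < n"
  then have "1 \<le> n - i \<and> n - i < n" "odd (n - i) \<longleftrightarrow> even i" using \<open>odd n\<close> by auto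
  then show "if odd i then (flip n \<circ> w \<circ> flip n) (i + 1) < (flip n \<circ> w \<circ> flip n) i
      else (flip n \<circ> w \<circ> flip n) i < (flip n \<circ> w \<circ> flip n) (i + 1)"
    using flip_conj_less[OF assms(1)] i assms(3) unfolding reverse_alternating_def by metis
qed

lemma d_eq_d_star_odd:
  assumes "odd n"
  shows "d k n = d_star k n"
proof -
  have inv: "flip n \<circ> (flip n \<circ> w \<circ> flip n) \<circ> flip n = w" for w
    by (auto simp: fun_eq_iff)
  have "bij_betw (\<lambda>w. flip n \<circ> w \<circ> flip n)
    {w. w permutes {1..n} \<and> alternating n w \<and> card (fixed_points n w) = k}
    {w. w permutes {1..n} \<and> reverse_alternating n w \<and> card (fixed_points n w) = k}"
    using assms flip_conj_permutes flip_conj_alternating flip_conj_reverse_alternating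
    by (intro bij_betw_byWitness[where f' = "\<lambda>w. flip n \<circ> w \<circ> flip n"])
       (auto simp only: inv card_fixed_points_flip_conj)
  then show ?thesis unfolding d_def d_star_def by (rule bij_betw_same_card)
qed

theorem theorem2p2:
  fixes m :: nat
  assumes "m \<ge> 1"
  shows "d_star (m + 1) (2 * m) = derangements (m - 1)
    \<and> d m (2 * m - 1) = derangements (m - 1)
    \<and> d_star m (2 * m - 1) = derangements (m - 1)"
proof -
  \<comment> \<open>The extremal count \<open>n div 2 + 1\<close> is \<open>m\<close> for the odd
    length; \<open>m \<ge> 1\<close> keeps the subtraction from truncating.\<close>
  have "(2 * m - 1) div 2 + 1 = m" "odd (2 * m - 1)" using assms by auto
  then show ?thesis
    using d_star_extremal[OF assms, of "2 * m"] d_star_extremal[OF assms, of "2 * m - 1"]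
    by (simp add: d_eq_d_star_odd)
qed

end
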